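(* Let $N\ge 7$ be an odd integer, let $r$ be an integer with $1\le r\le (N-3)/2$, and let $\ell\in\{1,\dots,(N-1)/2\}$. Then the average hitting time from vertex $0$ to vertex $\ell$ of the simple random walk on $G_N^{(r)}$ is \[ h(0,\ell)=2(N-1-2r)\sum_{m=1}^{(N-1)/2}\frac{1-\cos\left(\frac{2\pi m\ell}{N}\right)}{(N-2r)+2\sum_{j=1}^{r}\cos\left(\frac{2\pi mj}{N}\right)}. \]
   Context: For odd $N$ and $1\le r\le (N-3)/2$, the graph $G_N^{(r)}$ has vertex set $\mathbb Z/N\mathbb Z$; two distinct vertices $x,y$ are adjacent iff their circular distance $\min\{|x-y|,N-|x-y|\}$ (with representatives in $\{0,\dots,N-1\}$) lies in $\{r+1,\dots,(N-1)/2\}$. The simple random walk moves at each step from the current vertex to a uniformly random neighbor. $h(x,y)=\mathbb E_x[T_y]$, where $T_y$ is the hitting time of $y$ and the walk starts at $x$. *)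

theory Defs
  imports "HOL-Probability.Probability"
begin

definition neighbours :: "'v set \<Rightarrow> ('v \<Rightarrow> 'v \<Rightarrow> bool) \<Rightarrow> 'v \<Rightarrow> 'v set" where
  "neighbours V E v = {w \<in> V. E v w}"

text \<open>
  A simple random walk is any process, on any probability space, that has the Markov transition
  law below, where \<open>pmf_of_set\<close> is the uniform distribution on a finite nonempty set. The final
  lemma of this theory shows that such a process always exists if the vertex set is countable and every
  vertex has a positive finite number of neighbours.
\<close>

locale simple_random_walk = prob_space M
  for M :: "'w measure" +
  fixes V :: "'v set" and E :: "'v \<Rightarrow> 'v \<Rightarrow> bool" and X :: "nat \<Rightarrow> 'w \<Rightarrow> 'v" and x :: 'v
  assumes measurable_walk: "\<And>n. X n \<in> measurable M (count_space V)"
    and start: "AE \<omega> in M. X 0 \<omega> = x"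
    and step: "\<And>n v w. \<P>(\<omega> in M. \<forall>i\<le>n. X i \<omega> = v i) > 0 \<Longrightarrow>
      \<P>(\<omega> in M. X (Suc n) \<omega> = w \<bar> \<forall>i\<le>n. X i \<omega> = v i)
        = pmf (pmf_of_set (neighbours V E (v n))) w"

text \<open>The infimum of the empty set is \<open>\<infinity>\<close> in \<^typ>\<open>enat\<close>, so the hitting time is infinite
  on trajectories that never visit \<open>y\<close>.\<close>

definition hitting_time :: "(nat \<Rightarrow> 'w \<Rightarrow> 'v) \<Rightarrow> 'v \<Rightarrow> 'w \<Rightarrow> enat" where
  "hitting_time X y \<omega> = (INF n\<in>{n. X n \<omega> = y}. enat n)"

definition mean_hitting_time :: "'w measure \<Rightarrow> (nat \<Rightarrow> 'w \<Rightarrow> 'v) \<Rightarrow> 'v \<Rightarrow> ennreal" where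
  "mean_hitting_time M X y = (\<integral>\<^sup>+ \<omega>. ennreal_of_enat (hitting_time X y \<omega>) \<partial>M)"

text \<open>The vertices, residues modulo \<open>N\<close>, are represented by \<open>0, \<dots>, N - 1\<close>;
  for such \<open>x\<close> and \<open>y\<close> the natural-number subtraction below does not truncate.\<close>

definition circular_dist :: "nat \<Rightarrow> nat \<Rightarrow> nat \<Rightarrow> nat" where
  "circular_dist N x y = (let d = nat \<bar>int x - int y\<bar> in min d (N - d))"

definition G_verts :: "nat \<Rightarrow> nat set" where
  "G_verts N = {0..<N}"

definition G_adj :: "nat \<Rightarrow> nat \<Rightarrow> nat \<Rightarrow> nat \<Rightarrow> bool" where
  "G_adj N r x y \<longleftrightarrow> x \<noteq> y \<and> circular_dist N x y \<in> {r + 1..(N - 1) div 2}"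

text \<open>
  Existence of simple random walks: give every vertex at every time an independent uniformly
  chosen neighbour, and let the walk follow these choices.
\<close>

primrec follow :: "'v \<Rightarrow> nat \<Rightarrow> (nat \<times> 'v \<Rightarrow> 'v) \<Rightarrow> 'v" where
  "follow x 0 \<omega> = x"
| "follow x (Suc n) \<omega> = \<omega> (n, follow x n \<omega>)"

lemma simple_random_walk_exists:
  fixes V :: "'v set"
  assumes V: "countable V" and x: "x \<in> V"
    and fin: "\<And>v. v \<in> V \<Longrightarrow> finite (neighbours V E v)"
    and ne: "\<And>v. v \<in> V \<Longrightarrow> neighbours V E v \<noteq> {}"
  shows "\<exists>(M :: (nat \<times> 'v \<Rightarrow> 'v) measure) X. simple_random_walk M V E X x"
proof -
  define v' where "v' = (\<lambda>v. if v \<in> V then v else x)"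
  define K where "K = (\<lambda>p :: nat \<times> 'v. uniform_count_measure (neighbours V E (v' (snd p))))"
  define I where "I = (UNIV :: nat set) \<times> V"
  define M where "M = PiM I K"
  have v'V: "v' v \<in> V" for v using x by (simp add: v'_def)
  have psK: "prob_space (K p)" for p
    unfolding K_def by (intro prob_space_uniform_count_measure fin ne v'V)
  interpret product_prob_space K I
    by (intro product_prob_spaceI psK)
  have psM: "prob_space M" unfolding M_def by (rule prob_space_PiM) (rule psK)
  have spK: "space (K p) = neighbours V E (v' (snd p))"
    and setsK: "sets (K p) = Pow (neighbours V E (v' (snd p)))" for p
    by (simp_all add: K_def space_uniform_count_measure sets_uniform_count_measure)
  have coord: "\<omega> (n, v) \<in> neighbours V E v" if "\<omega> \<in> space M" "v \<in> V" for \<omega> n v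
    using that by (auto simp: M_def space_PiM PiE_iff I_def spK v'_def)
  have nV: "neighbours V E v \<subseteq> V" for v by (auto simp: neighbours_def)
  have inV: "follow x n \<omega> \<in> V" if "\<omega> \<in> space M" for n \<omega>
    by (induction n) (use x coord[OF that] nV in auto)
  have mc: "(\<lambda>\<omega>. \<omega> (n, v)) \<in> measurable M (count_space V)" if "v \<in> V" for n v
  proof -
    have "(\<lambda>\<omega>. \<omega> (n, v)) \<in> measurable M (K (n, v))"
      unfolding M_def using that by (intro measurable_component_singleton) (simp add: I_def)
    moreover have "id \<in> measurable (K (n, v)) (count_space V)"
      using subsetD[OF nV] by (auto simp: measurable_def spK setsK)
    ultimately show ?thesis using measurable_comp by (force simp: comp_def id_def)
  qed
  have meas: "follow x n \<in> measurable M (count_space V)" for n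
  proof (induction n)
    case 0
    have "follow x 0 = (\<lambda>_ :: nat \<times> 'v \<Rightarrow> 'v. x)" by (simp add: fun_eq_iff)
    then show ?case using x by simp
  next
    case (Suc n)
    have "(\<lambda>\<omega>. \<omega> (n, follow x n \<omega>)) \<in> measurable M (count_space V)"
      by (rule measurable_compose_countable'[where f = "\<lambda>v \<omega>. \<omega> (n, v)" and I = V])
        (use mc Suc V in auto)
    then show ?case by simp
  qed
  have path: "(\<forall>i\<le>n. follow x i \<omega> = v i) \<longleftrightarrow> v 0 = x \<and> (\<forall>i<n. \<omega> (i, v i) = v (Suc i))" for n v \<omega>
  proof (induction n)
    case 0
    then show ?case by auto
  next
    case (Suc n)
    have "(\<forall>i\<le>Suc n. follow x i \<omega> = v i) \<longleftrightarrow> (\<forall>i\<le>n. follow x i \<omega> = v i) \<and> \<omega> (n, v n) = v (Suc n)"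
      by (metis follow.simps(2) le_Suc_eq order_refl)
    then show ?case using Suc by (metis less_Suc_eq)
  qed
  have prob_path: "\<P>(\<omega> in M. \<forall>i<n. \<omega> (i, v i) = v (Suc i))
      = (\<Prod>i<n. 1 / card (neighbours V E (v i)))"
    if v: "\<And>i. i \<le> n \<Longrightarrow> v i \<in> V" and vs: "\<And>i. i < n \<Longrightarrow> v (Suc i) \<in> neighbours V E (v i)"
    for n v
  proof -
    let ?J = "(\<lambda>i. (i, v i)) ` {..<n}"
    have inj: "inj_on (\<lambda>i. (i, v i)) {..<n}" by (auto simp: inj_on_def)
    have v'i: "v' (v i) = v i" if "i < n" for i using v[of i] that by (simp add: v'_def)
    have "{\<omega> \<in> space M. \<forall>i<n. \<omega> (i, v i) = v (Suc i)}
        = {\<omega> \<in> space (PiM I K). \<forall>p\<in>?J. \<omega> p \<in> {v (Suc (fst p))}}"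
      by (auto simp: M_def)
    also have "emeasure (PiM I K) \<dots> = (\<Prod>p\<in>?J. emeasure (K p) {v (Suc (fst p))})"
      using v vs by (intro emeasure_PiM_Collect) (auto simp: I_def setsK v'i)
    also have "\<dots> = (\<Prod>i<n. emeasure (K (i, v i)) {v (Suc i)})"
      by (simp add: prod.reindex[OF inj])
    also have "\<dots> = (\<Prod>i<n. ennreal (1 / card (neighbours V E (v i))))"
    proof (intro prod.cong refl)
      fix i assume "i \<in> {..<n}"
      then have i: "i < n" by simp
      then have "v i \<in> V" using v by simp
      then show "emeasure (K (i, v i)) {v (Suc i)} = ennreal (1 / card (neighbours V E (v i)))"
        using vs[OF i] fin by (simp add: K_def v'i[OF i] emeasure_uniform_count_measure)
    qed
    also have "\<dots> = ennreal (\<Prod>i<n. 1 / card (neighbours V E (v i)))"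
      by (intro prod_ennreal) simp
    finally show ?thesis by (simp add: measure_def M_def prod_nonneg)
  qed
  have "simple_random_walk M V E (follow x) x"
  proof (intro simple_random_walk.intro[OF psM] simple_random_walk_axioms.intro)
    show "follow x n \<in> measurable M (count_space V)" for n by (rule meas)
    show "AE \<omega> in M. follow x 0 \<omega> = x" by simp
  next
    fix n v w
    let ?A = "{\<omega> \<in> space M. \<forall>i\<le>n. follow x i \<omega> = v i}"
    assume pos: "\<P>(\<omega> in M. \<forall>i\<le>n. follow x i \<omega> = v i) > 0"
    then have "?A \<noteq> {}" by (metis less_irrefl measure_empty)
    then obtain \<omega>0 where \<omega>0: "\<omega>0 \<in> space M" "\<And>i. i \<le> n \<Longrightarrow> follow x i \<omega>0 = v i" by blast
    have vV: "v i \<in> V" if "i \<le> n" for i using inV[OF \<omega>0(1)] \<omega>0(2)[OF that] by metis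
    have v0: "v 0 = x" using \<omega>0(2)[of 0] by simp
    have vs: "v (Suc i) \<in> neighbours V E (v i)" if "i < n" for i
      using \<omega>0(2)[of i] \<omega>0(2)[of "Suc i"] coord[OF \<omega>0(1) vV[of i], of i] that by auto
    let ?N = "neighbours V E (v n)"
    have N: "finite ?N" "?N \<noteq> {}" using fin ne vV by auto
    have pA: "\<P>(\<omega> in M. \<forall>i\<le>n. follow x i \<omega> = v i) = (\<Prod>i<n. 1 / card (neighbours V E (v i)))"
      using prob_path[of n v] vV vs v0 by (simp add: path)
    show "\<P>(\<omega> in M. follow x (Suc n) \<omega> = w \<bar> \<forall>i\<le>n. follow x i \<omega> = v i)
        = pmf (pmf_of_set ?N) w"
    proof (cases "w \<in> ?N")
      case True
      let ?u = "v(Suc n := w)"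
      have u: "?u i \<in> V" if "i \<le> Suc n" for i using vV that subsetD[OF nV True] by (auto simp: le_Suc_eq)
      have us: "?u (Suc i) \<in> neighbours V E (?u i)" if "i < Suc n" for i
        using vs that True by (auto simp: less_Suc_eq)
      have "{\<omega> \<in> space M. follow x (Suc n) \<omega> = w \<and> (\<forall>i\<le>n. follow x i \<omega> = v i)}
          = {\<omega> \<in> space M. \<forall>i\<le>Suc n. follow x i \<omega> = ?u i}"
        by (auto simp: le_Suc_eq simp del: follow.simps)
      also have "\<dots> = {\<omega> \<in> space M. \<forall>i<Suc n. \<omega> (i, ?u i) = ?u (Suc i)}"
        using v0 by (simp only: path) simp
      finally have "\<P>(\<omega> in M. follow x (Suc n) \<omega> = w \<and> (\<forall>i\<le>n. follow x i \<omega> = v i))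
          = (\<Prod>i<Suc n. 1 / card (neighbours V E (?u i)))"
        using prob_path[of "Suc n" ?u, OF u us] by metis
      also have "\<dots> = (\<Prod>i<n. 1 / card (neighbours V E (v i))) * (1 / card ?N)"
        by simp
      finally show ?thesis
        using pos True N unfolding cond_prob_def pA[symmetric] by simp
    next
      case False
      have empty: "{\<omega> \<in> space M. follow x (Suc n) \<omega> = w \<and> (\<forall>i\<le>n. follow x i \<omega> = v i)} = {}"
        using coord[OF _ vV[of n], of _ n] False by auto
      show ?thesis unfolding cond_prob_def empty using False N by simp
    qed
  qed
  then show ?thesis by blast
qed

end

theory Submission imports Defs begin

text \<open>
  The mean hitting time of \<open>y\<close> is the value at the starting point of any nonnegative \<open>f\<close> on
  the finite vertex set with \<open>f y = 0\<close> and \<open>f = 1 + P f\<close> off \<open>y\<close>, where \<open>P\<close> averages over neighbours: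
  if \<open>a n\<close> is the expectation of \<open>f (X n)\<close> on the event \<open>T > n\<close>, then \<open>a (n + 1) = a n - \<P>(T > n)\<close>,
  and \<open>a n\<close> is at most a constant times \<open>\<P>(T > n)\<close>, so the probabilities \<open>\<P>(T > n)\<close> sum to \<open>a 0\<close>.
  For the circulant graph, \<open>P\<close> multiplies \<open>cos (2\<pi>m(x - l)/N)\<close> by \<open>1 - D m / k\<close>, where \<open>k\<close> is the
  degree and \<open>D m\<close> the denominator in the formula; hence the formula with \<open>x - l\<close> in place of \<open>l\<close>
  solves the equation, the constant \<open>1\<close> arising from the vanishing of the Dirichlet kernel at
  nonzero residues.
\<close>

text \<open>Reduces each tail event to finitely many coordinates of the walk. If \<open>y\<close> is
  never visited the infimum is infinite, so the equivalence holds there too.\<close>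

lemma less_hitting_time_iff: "enat n < hitting_time X y \<omega> \<longleftrightarrow> (\<forall>i\<le>n. X i \<omega> \<noteq> y)"
proof
  assume n: "enat n < hitting_time X y \<omega>"
  show "\<forall>i\<le>n. X i \<omega> \<noteq> y"
  proof (intro allI impI notI)
    fix i assume "i \<le> n" "X i \<omega> = y"
    then have "hitting_time X y \<omega> \<le> enat i"
      unfolding hitting_time_def by (intro INF_lower) auto
    with n \<open>i \<le> n\<close> show False
      by (metis enat_ord_simps(1) leD order_trans)
  qed
next
  assume avoid: "\<forall>i\<le>n. X i \<omega> \<noteq> y"
  have "enat (Suc n) \<le> hitting_time X y \<omega>"
    unfolding hitting_time_def using avoid
    by (intro INF_greatest) (auto simp: Suc_le_eq not_le[symmetric])
  then show "enat n < hitting_time X y \<omega>"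
    by (meson enat_ord_simps(2) lessI less_le_trans)
qed

section \<open>Path probabilities and expected hitting times of a simple random walk\<close>

context simple_random_walk
begin

lemma walk_in_V: "\<omega> \<in> space M \<Longrightarrow> X n \<omega> \<in> V"
  using measurable_space[OF measurable_walk, of \<omega> n] by simp

lemma walk_sets: "{\<omega> \<in> space M. X n \<omega> \<in> B} \<in> sets M"
proof -
  have "{\<omega> \<in> space M. X n \<omega> \<in> B} = X n -` (B \<inter> V) \<inter> space M"
    using walk_in_V by auto
  then show ?thesis
    using measurable_sets[OF measurable_walk, of "B \<inter> V" n] by simp
qed

lemma path_sets: "{\<omega> \<in> space M. \<forall>i\<le>n. X i \<omega> = u i} \<in> sets M"
proof -
  have "{\<omega> \<in> space M. \<forall>i\<in>{..n}. X i \<omega> \<in> {u i}} \<in> sets M"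
    by (intro sets.sets_Collect_finite_All' walk_sets) auto
  then show ?thesis by (simp only: Ball_def atMost_iff Compl_iff singleton_iff)
qed

lemma avoid_sets: "{\<omega> \<in> space M. \<forall>i\<le>n. X i \<omega> \<noteq> y} \<in> sets M"
proof -
  have "{\<omega> \<in> space M. \<forall>i\<in>{..n}. X i \<omega> \<in> - {y}} \<in> sets M"
    by (intro sets.sets_Collect_finite_All' walk_sets) auto
  then show ?thesis by (simp only: Ball_def atMost_iff Compl_iff singleton_iff)
qed

lemma visit_avoid_sets: "{\<omega> \<in> space M. X n \<omega> = v \<and> (\<forall>i\<le>n. X i \<omega> \<noteq> y)} \<in> sets M"
  using sets.sets_Collect_conj[OF avoid_sets walk_sets[of n "{v}"]] by simp

text \<open>The transition law in product form. It also covers paths of probability zero, where both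
  sides vanish, so sums over all paths need no case split.\<close>

lemma prob_step:
  "prob {\<omega> \<in> space M. X (Suc n) \<omega> = w \<and> (\<forall>i\<le>n. X i \<omega> = u i)}
    = prob {\<omega> \<in> space M. \<forall>i\<le>n. X i \<omega> = u i} * pmf (pmf_of_set (neighbours V E (u n))) w"
proof (cases "prob {\<omega> \<in> space M. \<forall>i\<le>n. X i \<omega> = u i} > 0")
  case True
  then show ?thesis
    using step[OF True, of w] by (simp add: cond_prob_def field_simps)
next
  case False
  then have 0: "prob {\<omega> \<in> space M. \<forall>i\<le>n. X i \<omega> = u i} = 0"
    using measure_nonneg[of M] by (simp add: not_less order_antisym)
  have "prob {\<omega> \<in> space M. X (Suc n) \<omega> = w \<and> (\<forall>i\<le>n. X i \<omega> = u i)}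
      \<le> prob {\<omega> \<in> space M. \<forall>i\<le>n. X i \<omega> = u i}"
    by (intro finite_measure_mono path_sets) auto
  with 0 show ?thesis
    using measure_nonneg[of M] by (simp add: order_antisym)
qed

text \<open>The transition law conditions on a complete path, so an event must be split along
  initial paths before it applies. \<open>Q\<close> will fix the position at time \<open>n\<close>
  or \<open>Suc n\<close>.\<close>

lemma prob_sum_paths:
  assumes "finite V" and "B \<subseteq> V" and Q: "{\<omega> \<in> space M. Q \<omega>} \<in> sets M"
  shows "prob {\<omega> \<in> space M. Q \<omega> \<and> (\<forall>i\<le>n. X i \<omega> \<in> B)}
    = (\<Sum>u\<in>{..n} \<rightarrow>\<^sub>E B. prob {\<omega> \<in> space M. Q \<omega> \<and> (\<forall>i\<le>n. X i \<omega> = u i)})"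
proof -
  let ?A = "\<lambda>u. {\<omega> \<in> space M. Q \<omega> \<and> (\<forall>i\<le>n. X i \<omega> = u i)}"
  have fin: "finite ({..n} \<rightarrow>\<^sub>E B)"
    using assms by (intro finite_PiE) (auto intro: finite_subset)
  have sets: "?A u \<in> sets M" for u
    using sets.sets_Collect_conj[OF path_sets Q] .
  \<comment> \<open>Paths are extensional functions, so two distinct ones already differ at some
    time up to \<open>n\<close>.\<close>
  have disj: "disjoint_family_on ?A ({..n} \<rightarrow>\<^sub>E B)"
    unfolding disjoint_family_on_def
  proof (intro ballI impI)
    fix u u' assume u: "u \<in> {..n} \<rightarrow>\<^sub>E B" "u' \<in> {..n} \<rightarrow>\<^sub>E B" "u \<noteq> u'"
    then obtain i where "i \<le> n" "u i \<noteq> u' i"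
      using PiE_ext[OF u(1,2)] by auto
    then show "?A u \<inter> ?A u' = {}" by auto
  qed
  have "{\<omega> \<in> space M. Q \<omega> \<and> (\<forall>i\<le>n. X i \<omega> \<in> B)} = (\<Union>u\<in>{..n} \<rightarrow>\<^sub>E B. ?A u)" (is "?L = ?R")
  proof
    show "?L \<subseteq> ?R"
    proof
      fix \<omega> assume "\<omega> \<in> ?L"
      then have "restrict (\<lambda>i. X i \<omega>) {..n} \<in> {..n} \<rightarrow>\<^sub>E B"
        and "\<omega> \<in> ?A (restrict (\<lambda>i. X i \<omega>) {..n})" by auto
      then show "\<omega> \<in> ?R" by blast
    qed
  qed (auto simp: PiE_iff)
  then show ?thesis
    using finite_measure_finite_Union[OF fin _ disj] sets by (simp add: image_subset_iff)
qed

text \<open>The forward equation for the walk killed at \<open>y\<close>: paths are grouped by their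
  last vertex, the only one on which the transition factor depends.\<close>

lemma prob_avoid_step:
  assumes V: "finite V" and w: "w \<noteq> y"
  shows "prob {\<omega> \<in> space M. X (Suc n) \<omega> = w \<and> (\<forall>i\<le>Suc n. X i \<omega> \<noteq> y)}
    = (\<Sum>v\<in>V - {y}. prob {\<omega> \<in> space M. X n \<omega> = v \<and> (\<forall>i\<le>n. X i \<omega> \<noteq> y)}
        * pmf (pmf_of_set (neighbours V E v)) w)"
proof -
  let ?U = "{..n} \<rightarrow>\<^sub>E (V - {y})"
  let ?p = "\<lambda>v. pmf (pmf_of_set (neighbours V E v)) w"
  let ?P = "\<lambda>u. prob {\<omega> \<in> space M. \<forall>i\<le>n. X i \<omega> = u i}"
  have B: "(\<forall>i\<le>n. X i \<omega> \<in> V - {y}) \<longleftrightarrow> (\<forall>i\<le>n. X i \<omega> \<noteq> y)" if "\<omega> \<in> space M" for \<omega>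
    using walk_in_V that by auto
  have fin: "finite ?U" using V by (intro finite_PiE) auto
  have last_step: "(\<Sum>u | u \<in> ?U \<and> u n = v. ?P u)
      = prob {\<omega> \<in> space M. X n \<omega> = v \<and> (\<forall>i\<le>n. X i \<omega> \<noteq> y)}" for v
  proof -
    have "{\<omega> \<in> space M. X n \<omega> = v \<and> (\<forall>i\<le>n. X i \<omega> \<noteq> y)}
        = {\<omega> \<in> space M. X n \<omega> = v \<and> (\<forall>i\<le>n. X i \<omega> \<in> V - {y})}"
      using B by auto
    also have "prob \<dots> = (\<Sum>u\<in>?U. prob {\<omega> \<in> space M. X n \<omega> = v \<and> (\<forall>i\<le>n. X i \<omega> = u i)})"
      using walk_sets[of n "{v}"] V by (subst prob_sum_paths) auto
    also have "\<dots> = (\<Sum>u\<in>?U. if u n = v then ?P u else 0)"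
    proof (intro sum.cong refl)
      fix u
      have "{\<omega> \<in> space M. X n \<omega> = v \<and> (\<forall>i\<le>n. X i \<omega> = u i)}
          = (if u n = v then {\<omega> \<in> space M. \<forall>i\<le>n. X i \<omega> = u i} else {})"
        by auto
      then show "prob {\<omega> \<in> space M. X n \<omega> = v \<and> (\<forall>i\<le>n. X i \<omega> = u i)}
          = (if u n = v then ?P u else 0)" by simp
    qed
    also have "\<dots> = (\<Sum>u | u \<in> ?U \<and> u n = v. ?P u)"
      using fin by (simp add: sum.inter_filter)
    finally show ?thesis by simp
  qed
  \<comment> \<open>At time \<open>Suc n\<close> avoidance is automatic because \<open>w\<close>
    differs from \<open>y\<close>; only the constraint up to time \<open>n\<close> survives.\<close>
  have "{\<omega> \<in> space M. X (Suc n) \<omega> = w \<and> (\<forall>i\<le>Suc n. X i \<omega> \<noteq> y)}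
      = {\<omega> \<in> space M. X (Suc n) \<omega> = w \<and> (\<forall>i\<le>n. X i \<omega> \<in> V - {y})}"
    using w B by (auto simp: le_Suc_eq)
  also have "prob \<dots> = (\<Sum>u\<in>?U. ?P u * ?p (u n))"
    using walk_sets[of "Suc n" "{w}"] V
    by (subst prob_sum_paths) (auto simp: prob_step)
  also have "\<dots> = (\<Sum>v\<in>V - {y}. \<Sum>u | u \<in> ?U \<and> u n = v. ?P u * ?p (u n))"
    using V fin by (intro sum.group[symmetric]) auto
  also have "\<dots> = (\<Sum>v\<in>V - {y}. (\<Sum>u | u \<in> ?U \<and> u n = v. ?P u) * ?p v)"
    by (auto simp: sum_distrib_right intro!: sum.cong)
  finally show ?thesis by (simp only: last_step)
qed

theorem mean_hitting_time_eq:
  assumes V: "finite V" and xy: "x \<noteq> y"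
    and ne: "\<And>v. v \<in> V - {y} \<Longrightarrow> neighbours V E v \<noteq> {}"
    and f_nonneg: "\<And>v. v \<in> V \<Longrightarrow> f v \<ge> 0" and fy: "f y = (0::real)"
    and f: "\<And>v. v \<in> V - {y} \<Longrightarrow>
      f v = 1 + (\<Sum>w\<in>neighbours V E v. f w) / card (neighbours V E v)"
  shows "mean_hitting_time M X y = ennreal (f x)"
proof -
  \<comment> \<open>\<open>q n\<close> is the law at time \<open>n\<close> of the walk killed at
    \<open>y\<close>, and \<open>S n\<close> is its total mass.\<close>
  define q where "q n v = prob {\<omega> \<in> space M. X n \<omega> = v \<and> (\<forall>i\<le>n. X i \<omega> \<noteq> y)}" for n v
  define S where "S n = prob {\<omega> \<in> space M. \<forall>i\<le>n. X i \<omega> \<noteq> y}" for n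
  define a where "a n = (\<Sum>v\<in>V. q n v * f v)" for n
  have q_nonneg: "q n v \<ge> 0" for n v by (simp add: q_def)
  have S_sum: "S n = (\<Sum>v\<in>V. q n v)" for n
  proof -
    have "{\<omega> \<in> space M. \<forall>i\<le>n. X i \<omega> \<noteq> y}
        = (\<Union>v\<in>V. {\<omega> \<in> space M. X n \<omega> = v \<and> (\<forall>i\<le>n. X i \<omega> \<noteq> y)})"
      using walk_in_V by auto
    then show ?thesis
      unfolding S_def q_def using V visit_avoid_sets
      by (subst finite_measure_finite_Union[symmetric]) (auto simp: disjoint_family_on_def)
  qed
  have qy: "q n y = 0" for n
  proof -
    have "{\<omega> \<in> space M. X n \<omega> = y \<and> (\<forall>i\<le>n. X i \<omega> \<noteq> y)} = {}" by auto
    then show ?thesis by (simp only: q_def measure_empty)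
  qed
  have sum_off: "(\<Sum>v\<in>V. q n v * g v) = (\<Sum>v\<in>V - {y}. q n v * g v)" for n g
    using V qy by (intro sum.mono_neutral_right) auto
  have a_Suc: "a (Suc n) = a n - S n" for n
  proof -
    have "a (Suc n) = (\<Sum>w\<in>V. \<Sum>v\<in>V - {y}. q n v * pmf (pmf_of_set (neighbours V E v)) w * f w)"
      unfolding a_def
    proof (intro sum.cong refl)
      fix w
      show "q (Suc n) w * f w
          = (\<Sum>v\<in>V - {y}. q n v * pmf (pmf_of_set (neighbours V E v)) w * f w)"
        \<comment> \<open>The forward equation fails at \<open>w = y\<close>, but that term is
          killed by \<open>f y = 0\<close>.\<close>
        using prob_avoid_step[OF V, of w y n] fy
        by (cases "w = y") (simp_all add: q_def sum_distrib_right)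
    qed
    also have "\<dots> = (\<Sum>v\<in>V - {y}. q n v * (\<Sum>w\<in>V. pmf (pmf_of_set (neighbours V E v)) w * f w))"
      by (subst sum.swap) (simp add: sum_distrib_left mult.assoc)
    also have "\<dots> = (\<Sum>v\<in>V - {y}. q n v * (f v - 1))"
    proof (intro sum.cong refl)
      fix v assume v: "v \<in> V - {y}"
      have sub: "neighbours V E v \<subseteq> V" by (auto simp: neighbours_def)
      have fin: "finite (neighbours V E v)" using sub V by (rule finite_subset)
      have "(\<Sum>w\<in>V. pmf (pmf_of_set (neighbours V E v)) w * f w)
          = (\<Sum>w\<in>neighbours V E v. f w / card (neighbours V E v))"
        using V sub ne[OF v] fin by (intro sum.mono_neutral_cong_right) auto
      also have "\<dots> = f v - 1" using f[OF v] by (simp add: sum_divide_distrib)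
      finally show "q n v * (\<Sum>w\<in>V. pmf (pmf_of_set (neighbours V E v)) w * f w)
          = q n v * (f v - 1)" by simp
    qed
    also have "\<dots> = a n - S n"
      unfolding a_def S_sum sum_off using sum_off[of n "\<lambda>_. 1"]
      by (simp add: right_diff_distrib sum_subtractf)
    finally show ?thesis .
  qed
  have a_nonneg: "a n \<ge> 0" for n
    unfolding a_def by (intro sum_nonneg mult_nonneg_nonneg q_nonneg f_nonneg)
  have a0: "a 0 = f x"
  proof -
    \<comment> \<open>Almost surely \<open>X 0\<close> equals \<open>x\<close> and lies in
      \<open>V\<close>; a constant statement holding almost everywhere in a probability space is
      true.\<close>
    have "AE \<omega> in M. x \<in> V"
      using start AE_space by eventually_elim (use walk_in_V in auto)
    then have xV: "x \<in> V" by simp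
    have q0: "q 0 v = (if v = x then 1 else 0)" for v
    proof (cases "v = x")
      case True
      have "AE \<omega> in M. X 0 \<omega> = v \<and> (\<forall>i\<le>0. X i \<omega> \<noteq> y)"
        using start by eventually_elim (use True xy in auto)
      then have "q 0 v = 1"
        unfolding q_def using prob_Collect_eq_1[OF visit_avoid_sets] by blast
      with True show ?thesis by simp
    next
      case False
      have "AE \<omega> in M. \<not> (X 0 \<omega> = v \<and> (\<forall>i\<le>0. X i \<omega> \<noteq> y))"
        using start by eventually_elim (use False in auto)
      then have "q 0 v = 0"
        unfolding q_def using prob_Collect_eq_0[OF visit_avoid_sets] by blast
      with False show ?thesis by simp
    qed
    show ?thesis unfolding a_def q0 using V xV by (simp add: if_distrib[of "\<lambda>c. c * _"] cong: if_cong)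
  qed
  have partial: "(\<Sum>i<n. S i) = f x - a n" for n
    by (induction n) (simp_all add: a0 a_Suc)
  have S_nonneg: "S n \<ge> 0" for n by (simp add: S_def)
  \<comment> \<open>The partial sums are \<open>f x - a n\<close>, hence at most \<open>f x\<close>.
    Summability gives \<open>S n\<close> tending to 0, which is what forces \<open>a n\<close> to 0
    next.\<close>
  have "summable S"
    using S_nonneg partial a_nonneg by (intro bounded_imp_summable[where B = "f x"])
      (auto simp: lessThan_Suc_atMost[symmetric] simp del: sum.lessThan_Suc)
  then have S_lim: "S \<longlonglongrightarrow> 0" by (rule summable_LIMSEQ_zero)
  have "a n \<le> S n * (\<Sum>v\<in>V. f v)" for n
    unfolding a_def S_sum sum_distrib_right
    using V f_nonneg q_nonneg by (intro sum_mono mult_left_mono member_le_sum) auto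
  then have "a \<longlonglongrightarrow> 0"
    using a_nonneg S_lim
    by (intro real_tendsto_sandwich[of "\<lambda>_. 0" a _ "\<lambda>n. S n * (\<Sum>v\<in>V. f v)"])
      (auto intro!: tendsto_eq_intros)
  then have "S sums f x"
    unfolding sums_def partial by (auto intro!: tendsto_eq_intros)
  have "hitting_time X y \<in> measurable M (count_space UNIV)"
  proof -
    \<comment> \<open>The index set of the infimum depends on the trajectory; putting the value
      \<infinity> at the other times makes it fixed, so measurability passes through the countable
      infimum.\<close>
    have "hitting_time X y = (\<lambda>\<omega>. INF n. if X n \<omega> = y then enat n else \<infinity>)"
      unfolding hitting_time_def
      by (intro ext antisym INF_greatest INF_mono) (auto intro: INF_lower2)
    moreover have "(\<lambda>\<omega>. INF n. if X n \<omega> = y then enat n else \<infinity>) \<in> measurable M (count_space UNIV)"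
    proof (intro measurable_INF measurable_If)
      show "{\<omega> \<in> space M. X n \<omega> = y} \<in> sets M" for n
        using walk_sets[of n "{y}"] by simp
    qed auto
    ultimately show ?thesis by simp
  qed
  moreover have "(\<Sum>n. ennreal (S n)) = ennreal (f x)"
    using \<open>S sums f x\<close> S_nonneg by (intro suminf_ennreal_eq)
  \<comment> \<open>The expectation of an extended natural is the sum over \<open>n\<close> of the
    probabilities that it exceeds \<open>n\<close>.\<close>
  ultimately show ?thesis
    unfolding mean_hitting_time_def
    by (simp add: nn_integral_enat_function less_hitting_time_iff emeasure_eq_measure S_def)
qed

end

section \<open>The Dirichlet kernel and its zeros\<close>

lemma dirichlet_kernel:
  fixes t :: real
  shows "(1 + 2 * (\<Sum>m = 1..h. cos (real m * t))) * sin (t / 2) = sin ((real h + 1 / 2) * t)"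
proof (induction h)
  case (Suc h)
  have "(1 + 2 * (\<Sum>m = 1..Suc h. cos (real m * t))) * sin (t / 2)
      = sin ((real h + 1 / 2) * t) + 2 * cos (real (Suc h) * t) * sin (t / 2)"
    using Suc by (simp add: algebra_simps)
  \<comment> \<open>Product-to-sum makes the induction telescope: the subtracted sine is the one
    supplied by the induction hypothesis.\<close>
  also have "2 * cos (real (Suc h) * t) * sin (t / 2)
      = sin (real (Suc h) * t + t / 2) - sin (real (Suc h) * t - t / 2)"
    by (simp only: sin_add sin_diff)
  finally show ?case by (simp add: algebra_simps add_divide_distrib)
qed (simp add: field_simps)

text \<open>With \<open>t = 2 * pi * d / (2 * h + 1)\<close>, the right side of the kernel identity
  is the sine of \<open>d * pi\<close>, hence 0, while \<open>t / 2\<close> is a nonzero angle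
  strictly between \<open>- pi\<close> and \<open>pi\<close>, so the factor
  \<open>sin (t / 2)\<close> can be cancelled.\<close>

lemma sum_cos_odd:
  fixes d :: int
  assumes "\<bar>d\<bar> < int (2 * h + 1)" and "d \<noteq> 0"
  shows "1 + 2 * (\<Sum>m = 1..h. cos (2 * pi * real m * d / real (2 * h + 1))) = 0"
proof -
  let ?N = "real (2 * h + 1)"
  let ?t = "2 * pi * d / ?N"
  have "\<bar>real_of_int d\<bar> < ?N" using assms(1) by linarith
  then have d: "- ?N < d" "d < ?N" by linarith+
  have "sin (?t / 2) \<noteq> 0"
  proof
    assume s: "sin (?t / 2) = 0"
    have "?t / 2 = pi * (d / ?N)" by (simp add: field_simps)
    moreover have "-1 < d / ?N" "d / ?N < 1" using d by (simp_all add: field_simps)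
    ultimately have "- pi < ?t / 2" "?t / 2 < pi"
      using mult_strict_left_mono[of "-1" "d / ?N" pi] mult_strict_left_mono[of "d / ?N" 1 pi] by auto
    then have "?t / 2 = 0" using s by (rule sin_eq_0_pi)
    with assms(2) show False by simp
  qed
  moreover have "(real h + 1 / 2) * ?t = d * pi" by (simp add: field_simps)
  then have "sin ((real h + 1 / 2) * ?t) = 0" by (simp add: sin_zero_iff_int2)
  ultimately have "1 + 2 * (\<Sum>m = 1..h. cos (real m * ?t)) = 0"
    using dirichlet_kernel[where h = h and t = ?t] by simp
  then show ?thesis by (simp add: mult_ac)
qed

text \<open>Neighbours are reached by displacements \<open>s\<close> and \<open>- s\<close> with
  \<open>s\<close> from \<open>r + 1\<close> to \<open>h\<close>. Periodicity of \<open>F\<close> on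
  the integers absorbs the wrap-around modulo \<open>N\<close>.\<close>

lemma sum_neighbours_G:
  fixes F :: "int \<Rightarrow> real"
  assumes per: "\<And>d. F (d + int N) = F d" and N: "N = 2 * h + 1" and x: "x < N"
  shows "(\<Sum>w\<in>neighbours (G_verts N) (G_adj N r) x. F (int w))
    = (\<Sum>s = r + 1..h. F (int x + int s) + F (int x - int s))"
proof -
  let ?A = "{int r + 1..int h}"
  let ?B = "{- int h..- int r - 1}"
  have per': "F (d - int N) = F d" for d using per[of "d - int N"] by simp
  have nb: "w \<in> neighbours (G_verts N) (G_adj N r) x \<longleftrightarrow>
      w < N \<and> (let d = \<bar>int w - int x\<bar> in (int r < d \<and> d \<le> int h) \<or> (int r < int N - d \<and> int N - d \<le> int h))" for w
    using N x
    by (auto simp: neighbours_def G_verts_def G_adj_def circular_dist_def Let_def min_def; linarith)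
  \<comment> \<open>\<open>i\<close> adds a displacement and reduces to the range from 0 to
    \<open>N - 1\<close>; \<open>j\<close> recovers the displacement as the centred representative
    between \<open>- h\<close> and \<open>h\<close>.\<close>
  define i where "i s = nat (if int x + s < 0 then int x + s + int N
    else if int x + s \<ge> int N then int x + s - int N else int x + s)" for s
  define j where "j w = (if int w - int x > int h then int w - int x - int N
    else if int w - int x < - int h then int w - int x + int N else int w - int x)" for w
  have "(\<Sum>w\<in>neighbours (G_verts N) (G_adj N r) x. F (int w)) = (\<Sum>s\<in>?A \<union> ?B. F (int x + s))"
  proof (rule sum.reindex_bij_witness[where i = i and j = j])
    fix w assume w: "w \<in> neighbours (G_verts N) (G_adj N r) x"
    then have "w < N" by (simp add: nb)
    then show "i (j w) = w" using N x by (simp add: i_def j_def)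
    show "j w \<in> ?A \<union> ?B" using w N x unfolding nb Let_def j_def by auto
    show "F (int x + j w) = F (int w)"
      using per[of "int w"] per'[of "int w"] by (simp add: j_def algebra_simps)
  next
    fix s assume s: "s \<in> ?A \<union> ?B"
    then have i: "int (i s) = (if int x + s < 0 then int x + s + int N
        else if int x + s \<ge> int N then int x + s - int N else int x + s)"
      using N x by (auto simp: i_def)
    show "j (i s) = s" using s N x by (auto simp: j_def i)
    show "i s \<in> neighbours (G_verts N) (G_adj N r) x"
      unfolding nb Let_def of_nat_less_iff[where 'a = int, symmetric] i using s N x by auto
  qed
  also have "\<dots> = (\<Sum>s\<in>?A. F (int x + s)) + (\<Sum>s\<in>?B. F (int x + s))"
    by (intro sum.union_disjoint) auto
  also have "(\<Sum>s\<in>?A. F (int x + s)) = (\<Sum>s = r + 1..h. F (int x + int s))"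
    by (rule sum.reindex_bij_witness[where i = int and j = nat]) auto
  also have "(\<Sum>s\<in>?B. F (int x + s)) = (\<Sum>s = r + 1..h. F (int x - int s))"
    by (rule sum.reindex_bij_witness[where i = "\<lambda>s. - int s" and j = "\<lambda>s. nat (- s)"]) auto
  finally show ?thesis by (simp add: sum.distrib)
qed

section \<open>Cosine eigenfunctions and the hitting-time formula\<close>

theorem corollary3p1:
  fixes N r l :: nat and M :: "'w measure" and X :: "nat \<Rightarrow> 'w \<Rightarrow> nat"
  assumes "N \<ge> 7" and "odd N"
    and "1 \<le> r" and "r \<le> (N - 3) div 2"
    and "l \<in> {1..(N - 1) div 2}"
    and "simple_random_walk M (G_verts N) (G_adj N r) X 0"
  shows "mean_hitting_time M X l = ennreal
    (2 * (real N - 1 - 2 * real r) *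
      (\<Sum>m = 1..(N - 1) div 2.
        (1 - cos (2 * pi * real m * real l / real N)) /
        ((real N - 2 * real r) + 2 * (\<Sum>j = 1..r. cos (2 * pi * real m * real j / real N)))))"
proof -
  interpret simple_random_walk M "G_verts N" "G_adj N r" X 0 by fact
  obtain h where N: "N = 2 * h + 1" using \<open>odd N\<close> by (auto elim: oddE)
  have h: "(N - 1) div 2 = h" "r < h" "l \<le> h" "1 \<le> l" "0 < N" "h > 0"
    using assms N by auto
  define k where "k = real N - 1 - 2 * real r"
  have k: "k = 2 * (real h - real r)" "k > 0" using N h by (auto simp: k_def)
  define c where "c m d = cos (2 * pi * real m * of_int d / real N)" for m and d :: int
  define D where "D m = (real N - 2 * real r) + 2 * (\<Sum>j = 1..r. c m (int j))" for m
  define f where "f d = 2 * k * (\<Sum>m = 1..h. (1 - c m (d - int l)) / D m)" for d :: int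
  have c_period: "c m (d + int N) = c m d" for m d
  proof -
    have "2 * pi * real m * of_int (d + int N) / real N
        = 2 * pi * real m * of_int d / real N + 2 * pi * of_int (int m)"
      using h by (simp add: field_simps)
    then show ?thesis
      by (simp only: c_def cos_add cos_int_2pin sin_int_2pin)
  qed
  have c_even: "c m (- d) = c m d" for m d by (simp add: c_def)
  have c_add: "c m (d + s) + c m (d - s) = 2 * c m d * c m s" for m d s
    by (simp add: c_def add_divide_distrib diff_divide_distrib cos_add cos_diff algebra_simps)
  have c_sum: "1 + 2 * (\<Sum>m = 1..h. c m d) = 0" if "\<bar>d\<bar> < int N" "d \<noteq> 0" for d
    using sum_cos_odd[of d h] that N by (simp add: c_def)
  \<comment> \<open>Since \<open>c\<close> is symmetric in frequency and displacement, the kernel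
    identity at \<open>m\<close> evaluates the sum over all displacements; this trades the sum up to
    \<open>r\<close> for the complementary one over actual neighbours.\<close>
  have D_eq: "D m = k - 2 * (\<Sum>s = r + 1..h. c m (int s))" if m: "m \<in> {1..h}" for m
  proof -
    have "1 + 2 * (\<Sum>s = 1..h. c s (int m)) = 0"
      using m N by (intro c_sum) auto
    moreover have "c s (int m) = c m (int s)" for s by (simp add: c_def mult_ac)
    moreover have "(\<Sum>s = 1..h. c m (int s)) = (\<Sum>s = 1..r. c m (int s)) + (\<Sum>s = r + 1..h. c m (int s))"
      using h sum.ub_add_nat[of 1 r "\<lambda>s. c m (int s)" "h - r"] by simp
    ultimately show ?thesis by (simp add: D_def k_def)
  qed
  have D_pos: "D m > 0" if m: "m \<in> {1..h}" for m
  proof -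
    have le: "c m s \<le> 1" for s by (simp add: c_def)
    \<comment> \<open>\<open>D m\<close> is a sum of nonnegative terms
      \<open>1 - c m (int s)\<close>, doubled, so one strict term suffices. The choice
      \<open>s = h\<close> works for every \<open>m\<close>: \<open>N - 2 * h = 1\<close> makes
      \<open>h\<close> coprime to \<open>N\<close>, and \<open>N\<close> cannot divide
      \<open>m\<close>.\<close>
    have "c m (int h) \<noteq> 1"
    proof
      assume "c m (int h) = 1"
      then obtain n where "2 * pi * real m * real h / real N = of_int n * 2 * pi"
        by (auto simp: c_def cos_one_2pi_int)
      then have "real m * real h = of_int n * real N" using h by (simp add: field_simps)
      then have "int m * int h = n * int N"
        by (metis (mono_tags) of_int_eq_iff of_int_mult of_int_of_nat_eq)
      then have "int N dvd int m * int h" by simp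
      moreover have "coprime (int N) (int h)"
      proof (rule coprimeI)
        fix b assume "b dvd int N" "b dvd int h"
        then have "b dvd int N - 2 * int h" by (intro dvd_diff dvd_mult)
        then show "is_unit b" using N by simp
      qed
      ultimately have "int N dvd int m" by (simp add: coprime_dvd_mult_left_iff)
      then have "N \<le> m" using m by (auto dest: dvd_imp_le)
      with m N show False by simp
    qed
    then have "c m (int h) < 1" using le[of "int h"] by (rule le_neq_trans[rotated])
    then have "(\<Sum>s = r + 1..h. 1 - c m (int s)) > 0"
      using h(2) le by (intro sum_pos2[of _ h]) auto
    moreover have "D m = 2 * (\<Sum>s = r + 1..h. 1 - c m (int s))"
      using h unfolding D_eq[OF m] k(1) by (simp add: sum_subtractf of_nat_diff)
    ultimately show ?thesis by simp
  qed
  have card_nb: "real (card (neighbours (G_verts N) (G_adj N r) x)) = k" if "x < N" for x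
    using sum_neighbours_G[of "\<lambda>_. 1" N h x r] that N h k by (simp add: of_nat_diff)
  have "mean_hitting_time M X l = ennreal (f (int 0))"
  proof (rule mean_hitting_time_eq[where f = "\<lambda>v. f (int v)"])
    show "finite (G_verts N)" by (simp add: G_verts_def)
    show "0 \<noteq> l" using h by simp
    show "f (int l) = 0" by (simp add: f_def c_def)
    show "f (int v) \<ge> 0" if "v \<in> G_verts N" for v
      unfolding f_def using k D_pos by (intro mult_nonneg_nonneg sum_nonneg divide_nonneg_pos) (auto simp: c_def)
  next
    fix v assume "v \<in> G_verts N - {l}"
    then have v: "v < N" "v \<noteq> l" by (auto simp: G_verts_def)
    let ?nb = "neighbours (G_verts N) (G_adj N r) v"
    show "?nb \<noteq> {}" using card_nb[OF v(1)] k by auto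
    let ?d = "int v - int l"
    \<comment> \<open>The shifted cosine is an eigenfunction of the adjacency operator with
      eigenvalue \<open>k - D m\<close>: the displacements \<open>s\<close> and \<open>- s\<close>
      combine by \<open>c_add\<close>.\<close>
    have nb: "(\<Sum>w\<in>?nb. c m (int w - int l)) = c m ?d * (k - D m)" if m: "m \<in> {1..h}" for m
    proof -
      have "(\<Sum>w\<in>?nb. c m (int w - int l))
          = (\<Sum>s = r + 1..h. c m (int v + int s - int l) + c m (int v - int s - int l))"
        using c_period[of m "_ - int l"] by (intro sum_neighbours_G N v(1)) (simp add: algebra_simps)
      also have "\<dots> = (\<Sum>s = r + 1..h. 2 * c m ?d * c m (int s))"
        by (intro sum.cong refl) (simp only: c_add[symmetric], simp add: algebra_simps)
      also have "\<dots> = c m ?d * (k - D m)"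
        unfolding D_eq[OF m] by (simp add: sum_distrib_left mult_ac)
      finally show ?thesis .
    qed
    have "(\<Sum>w\<in>?nb. f (int w)) = 2 * k * (\<Sum>m = 1..h. (\<Sum>w\<in>?nb. 1 - c m (int w - int l)) / D m)"
      unfolding f_def sum_divide_distrib by (subst sum.swap) (simp add: sum_distrib_left)
    also have "\<dots> = 2 * k * (\<Sum>m = 1..h. k * ((1 - c m ?d) / D m) + c m ?d)"
    proof (intro arg_cong[where f = "\<lambda>z. 2 * k * z"] sum.cong refl)
      fix m assume m: "m \<in> {1..h}"
      \<comment> \<open>The numerator is \<open>k * (1 - c m ?d) + c m ?d * D m\<close>, so the
        second part loses its denominator.\<close>
      show "(\<Sum>w\<in>?nb. 1 - c m (int w - int l)) / D m = k * ((1 - c m ?d) / D m) + c m ?d"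
        using D_pos[OF m] by (simp add: sum_subtractf nb[OF m] card_nb[OF v(1)] field_simps)
    qed
    also have "\<dots> = k * f (int v) + k * (2 * (\<Sum>m = 1..h. c m ?d))"
      by (simp add: f_def sum.distrib sum_distrib_left algebra_simps)
    \<comment> \<open>Here \<open>v \<noteq> l\<close> enters: the kernel vanishes at the nonzero
      residue \<open>?d\<close>, so the neighbour sum is \<open>k * f (int v) - k\<close>.\<close>
    also have "2 * (\<Sum>m = 1..h. c m ?d) = - 1"
    proof -
      have "\<bar>?d\<bar> < int N" using v(1) h(3) N by linarith
      then show ?thesis using c_sum[of ?d] v(2) by simp
    qed
    finally show "f (int v) = 1 + (\<Sum>w\<in>?nb. f (int w)) / card ?nb"
      using k(2) by (simp add: card_nb[OF v(1)] field_simps)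
  qed
  \<comment> \<open>At the vertex 0 the displacement is \<open>- int l\<close>; evenness of the
    cosine turns it into \<open>l\<close>.\<close>
  then show ?thesis
    using h by (simp add: f_def c_even D_def k_def c_def)
qed

end
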